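(* Let $S$ be a multi-dimensional elephant random walk on $\mathbb{Z}^2$ with parameter $p\in[0,5/8)$, let $a:=\frac{4p-1}{3}$ (so $a<1/2$), and let $s\in(a,1/2)$ be a positive constant. Then, almost surely, $\|S_n\|\le n^s$ for infinitely many $n$.
   Context: Multi-dimensional elephant random walk (MERW) on $\mathbb{Z}^d$ (here $d=2$): let $e_1,\dots,e_d$ be the standard basis of $\mathbb{R}^d$ and $p\in[0,1]$. Set $S_0=0$ and $S_1=\sigma_1=e_1$. For each $n\ge 1$, choose $n'$ uniformly at random in $\{1,\dots,n\}$ (independently of the past); given the past and $n'$, let $\sigma_{n+1}=\sigma_{n'}$ with probability $p$, and $\sigma_{n+1}=\sigma$ with probability $\frac{1-p}{2d-1}$ for each $\sigma\in\{\pm e_1,\dots,\pm e_d\}\setminus\{\sigma_{n'}\}$. Set $S_{n+1}=S_n+\sigma_{n+1}$. $\|\cdot\|$ is the Euclidean norm. *)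

theory Defs
  imports "HOL-Probability.Probability"
begin

definition unit_steps :: "(real ^ 'd) set" where
  "unit_steps = (\<Union>i. {axis i 1, - axis i 1})"

text \<open>
  The first basis vector is \<open>axis 1 1\<close>; the class \<open>one\<close> provides the index \<open>1\<close>, as in the
  numeral type \<open>2\<close>.

  \<open>\<sigma> n\<close> is the \<open>n\<close>-th step (only \<open>n \<ge> 1\<close> matters) and \<open>\<nu> n\<close> is the instant \<open>n'\<close>
  that is recalled to produce \<open>\<sigma> (n + 1)\<close>.  As steps take finitely many values almost surely,
  conditioning on the past is elementary conditioning on the non-null events
  \<open>\<sigma> 1 = x 1, \<dots>, \<sigma> n = x n\<close>; \<open>memory\<close> thus says that \<open>\<nu> n\<close> is uniform on \<open>{1..n}\<close> and
  independent of \<open>\<sigma> 1, \<dots>, \<sigma> n\<close>.  A past that also records earlier recalled instants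
  satisfies these conditions too, and yields the same law of the walk.
\<close>

locale elephant_random_walk = prob_space M
  for M :: "'w measure" +
  fixes p :: real
    and S :: "nat \<Rightarrow> 'w \<Rightarrow> real ^ ('d :: {finite, one})"
    and \<sigma> :: "nat \<Rightarrow> 'w \<Rightarrow> real ^ ('d :: {finite, one})"
    and \<nu> :: "nat \<Rightarrow> 'w \<Rightarrow> nat"
  assumes p_range: "0 \<le> p" "p \<le> 1"
    and step_measurable: "\<And>n. n \<ge> 1 \<Longrightarrow> \<sigma> n \<in> borel_measurable M"
    and memory_measurable: "\<And>n. n \<ge> 1 \<Longrightarrow> \<nu> n \<in> measurable M (count_space UNIV)"
    and walk_0: "\<And>\<omega>. \<omega> \<in> space M \<Longrightarrow> S 0 \<omega> = 0"
    and walk_Suc: "\<And>n \<omega>. \<omega> \<in> space M \<Longrightarrow> S (Suc n) \<omega> = S n \<omega> + \<sigma> (Suc n) \<omega>"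
    and first_step: "AE \<omega> in M. \<sigma> 1 \<omega> = axis 1 1"
    and memory:
      "\<And>n k x. \<lbrakk>n \<ge> 1; k \<in> {1..n}; \<P>(\<omega> in M. \<forall>i\<in>{1..n}. \<sigma> i \<omega> = x i) > 0\<rbrakk> \<Longrightarrow>
         \<P>(\<omega> in M. \<nu> n \<omega> = k \<bar> \<forall>i\<in>{1..n}. \<sigma> i \<omega> = x i) = 1 / real n"
    and step:
      "\<And>n k x e. \<lbrakk>n \<ge> 1; k \<in> {1..n}; e \<in> unit_steps;
           \<P>(\<omega> in M. (\<forall>i\<in>{1..n}. \<sigma> i \<omega> = x i) \<and> \<nu> n \<omega> = k) > 0\<rbrakk> \<Longrightarrow>
         \<P>(\<omega> in M. \<sigma> (Suc n) \<omega> = e \<bar> (\<forall>i\<in>{1..n}. \<sigma> i \<omega> = x i) \<and> \<nu> n \<omega> = k) =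
           (if e = x k then p else (1 - p) / (2 * real CARD('d) - 1))"

end

theory Submission
  imports Defs "HOL-Real_Asymp.Real_Asymp"
begin

text \<open>
  In the plane the logarithm is harmonic.  Along a walk with drift \<open>a S\<^sub>n / n\<close> and step covariance
  close to half the identity, the process \<open>ln \<parallel>S\<^sub>n\<parallel> - a ln n\<close> is therefore nearly a martingale.  If the
  walk stayed outside the curve \<open>n powr s\<close> with \<open>s > a\<close>, this process would be at least
  \<open>(s - a) ln n\<close>: a nearly constant expectation leaves no room for that on an event of positive
  probability.

  Second-order errors have to be controlled, since \<open>s\<close> may be so small that
  \<open>\<parallel>S\<^sub>n\<parallel>\<close> is far below its typical size.  The main ones come from two sources.  The discreteness of the steps
  costs a multiple of \<open>1 / \<parallel>S\<^sub>n\<parallel>\<^sup>4\<close>; and the covariance is off by a multiple of \<open>D\<^sub>n / n\<close>, where \<open>D\<^sub>n\<close> is the number of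
  horizontal minus the number of vertical steps so far, which costs a multiple of
  \<open>\<bar>D\<^sub>n\<bar> / (n \<parallel>S\<^sub>n\<parallel>\<^sup>2)\<close>.  Replacing \<open>ln \<parallel>x\<parallel>\<^sup>2\<close> by \<open>ln (\<parallel>x\<parallel>\<^sup>2 - K)\<close> makes the function strictly
  superharmonic, with a gain of about \<open>K / \<parallel>x\<parallel>\<^sup>4\<close>.  For large \<open>K\<close> this gain pays for the first error, and
  by the inequality of arithmetic and geometric means it turns the second one into a multiple of
  \<open>D\<^sub>n\<^sup>2 / (K n\<^sup>2)\<close> (lemma \<open>step_mean_log_le\<close>).  The process \<open>D\<^sub>n\<close> is a one-dimensional elephant random
  walk with the same \<open>a < 1/2\<close>, so \<open>D\<^sub>n\<^sup>2\<close> has expectation \<open>O(n)\<close> (lemma \<open>imbalance_second_moment\<close>).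

  Fix \<open>b\<close> with \<open>max a 0 < b < s\<close>.  While the walk is outside the curve, the expectation of
  \<open>ln (\<parallel>S\<^sub>n\<parallel>\<^sup>2 - K) - 2 b ln n\<close> grows at most like a constant multiple of \<open>(1 / K) ln n\<close>, while the quantity itself is at least
  about \<open>2 (s - b) ln n\<close> (lemma \<open>stays_outside_growth\<close>).  Hence the probability of staying outside
  forever is at most a constant multiple of \<open>1 / K\<close>, and \<open>K\<close> is arbitrary.

  The walk is a function of the finite list of its steps, so that all expectations are finite sums
  over such lists.
\<close>

section \<open>The law of the history of the steps\<close>

lemma unit_steps_eq_image: "unit_steps = (\<lambda>(i, s). s *\<^sub>R axis i 1) ` (UNIV \<times> {1, -1::real})"
  by (auto simp: unit_steps_def image_iff)

lemma finite_unit_steps: "finite (unit_steps :: (real ^ 'd) set)"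
  unfolding unit_steps_eq_image by simp

lemma card_unit_steps: "card (unit_steps :: (real ^ 'd) set) = 2 * CARD('d)"
proof -
  have "inj_on (\<lambda>(i, s). s *\<^sub>R axis i 1 :: real ^ 'd) (UNIV \<times> {1, -1::real})"
    by (auto simp: inj_on_def axis_eq_axis axis_def vec_eq_iff)
  then show ?thesis
    unfolding unit_steps_eq_image by (simp add: card_image card_cartesian_product)
qed

lemma norm_unit_step: "e \<in> unit_steps \<Longrightarrow> norm e = 1"
  by (auto simp: unit_steps_def)

definition histories :: "nat \<Rightarrow> (real ^ 'd) list set" where
  "histories n = {xs. set xs \<subseteq> unit_steps \<and> length xs = n}"

definition transition :: "real \<Rightarrow> (real ^ 'd) list \<Rightarrow> real ^ 'd \<Rightarrow> real" where
  "transition p xs e =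
     (\<Sum>y\<leftarrow>xs. if e = y then p else (1 - p) / (2 * real CARD('d) - 1)) / real (length xs)"

definition step_mean :: "real \<Rightarrow> (real ^ 'd) list \<Rightarrow> (real ^ 'd \<Rightarrow> real) \<Rightarrow> real" where
  "step_mean p xs g = (\<Sum>e\<in>unit_steps. transition p xs e * g e)"

lemma finite_histories: "finite (histories n)"
  unfolding histories_def by (intro finite_lists_length_eq finite_unit_steps)

lemma sum_histories_Suc:
  "(\<Sum>xs\<in>histories (Suc n). f xs) = (\<Sum>xs\<in>histories n. \<Sum>e\<in>unit_steps. f (xs @ [e]))"
proof -
  have "(\<Sum>xs\<in>histories (Suc n). f xs) = (\<Sum>(xs, e)\<in>histories n \<times> unit_steps. f (xs @ [e]))"
    by (rule sum.reindex_bij_witness[of _ "\<lambda>(xs, e). xs @ [e]" "\<lambda>xs. (butlast xs, last xs)"])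
       (auto simp: histories_def length_Suc_conv_rev)
  then show ?thesis by (simp add: sum.cartesian_product)
qed

text \<open>
  With \<open>q = (1 - p) / (2 d - 1)\<close>, recalling \<open>y\<close> gives the next step \<open>e\<close> the probability \<open>p\<close> if \<open>e = y\<close>
  and \<open>q\<close> otherwise, that is, \<open>p - q = a\<close> times the indicator of \<open>e = y\<close>, plus \<open>q\<close>.  The next step is thus
  formally a mixture, with weights \<open>a\<close> and \<open>1 - a\<close>, of a uniformly chosen past step and a uniform unit
  step.  The weight \<open>a\<close> may be negative.
\<close>

lemma step_mean_eq:
  fixes xs :: "(real ^ 'd) list" and p :: real
  assumes "xs \<noteq> []" "set xs \<subseteq> unit_steps"
  defines "a \<equiv> (2 * real CARD('d) * p - 1) / (2 * real CARD('d) - 1)"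
  shows "step_mean p xs g = a * ((\<Sum>y\<leftarrow>xs. g y) / real (length xs))
           + (1 - a) * ((\<Sum>e\<in>unit_steps. g e) / (2 * real CARD('d)))"
proof -
  define q where "q = (1 - p) / (2 * real CARD('d) - 1)"
  have d: "real CARD('d) \<ge> 1"
    using zero_less_card_finite[where 'a='d] by linarith
  have a: "p - q = a" and q: "q = (1 - a) / (2 * real CARD('d))"
  proof -
    define D where "D = real CARD('d)"
    have D: "D \<ge> 1" using d by (simp only: D_def)
    then have "2 * D - 1 \<noteq> 0" by linarith
    with D show "p - q = a" "q = (1 - a) / (2 * real CARD('d))"
      unfolding a_def q_def D_def[symmetric] by (simp_all add: field_simps)
  qed
  have split: "(if e = y then p else q) = a * (if e = y then 1 else 0) + q" for e y :: "real ^ 'd"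
    using a by auto
  have "step_mean p xs g * real (length xs)
      = (\<Sum>e\<in>unit_steps. (\<Sum>y\<leftarrow>xs. if e = y then p else q) * g e)"
    using assms(1) unfolding step_mean_def transition_def q_def by (simp add: sum_distrib_right)
  also have "\<dots> = (\<Sum>y\<leftarrow>xs. \<Sum>e\<in>unit_steps. (if e = y then p else q) * g e)"
    by (induction xs) (simp_all add: sum.distrib algebra_simps)
  also have "\<dots> = (\<Sum>y\<leftarrow>xs. a * g y + q * (\<Sum>e\<in>unit_steps. g e))"
  proof (intro arg_cong[of _ _ sum_list] map_cong refl)
    fix y assume "y \<in> set xs"
    then have "y \<in> unit_steps" using assms(2) by auto
    then have "(\<Sum>e\<in>unit_steps. (if e = y then 1 else 0) * g e) = g y"
      by (simp add: finite_unit_steps if_distrib[of "\<lambda>u. u * _"] sum.delta cong: if_cong)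
    then show "(\<Sum>e\<in>unit_steps. (if e = y then p else q) * g e) = a * g y + q * (\<Sum>e\<in>unit_steps. g e)"
      unfolding split by (simp add: distrib_right sum.distrib mult.assoc flip: sum_distrib_left)
  qed
  also have "\<dots> = a * (\<Sum>y\<leftarrow>xs. g y) + q * (\<Sum>e\<in>unit_steps. g e) * real (length xs)"
    by (induction xs) (simp_all add: algebra_simps)
  finally show ?thesis
    using assms(1) unfolding q by (simp add: field_simps)
qed

lemma transition_nonneg:
  fixes xs :: "(real ^ 'd) list"
  assumes "0 \<le> p" "p \<le> 1"
  shows "transition p xs e \<ge> 0"
proof -
  have "real CARD('d) \<ge> 1"
    using zero_less_card_finite[where 'a='d] by linarith
  then have "(1 - p) / (2 * real CARD('d) - 1) \<ge> 0"
    using assms by (intro divide_nonneg_nonneg) linarith+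
  then show ?thesis
    using assms unfolding transition_def by (intro divide_nonneg_nonneg sum_list_nonneg) auto
qed

lemma step_mean_mono:
  assumes "0 \<le> p" "p \<le> 1" "\<And>e. e \<in> unit_steps \<Longrightarrow> g e \<le> h e"
  shows "step_mean p xs g \<le> step_mean p xs h"
  unfolding step_mean_def
  by (intro sum_mono mult_left_mono transition_nonneg assms)

lemma step_mean_const:
  fixes xs :: "(real ^ 'd) list"
  assumes "xs \<noteq> []" "set xs \<subseteq> unit_steps"
  shows "step_mean p xs (\<lambda>_. c) = c"
proof -
  have "(\<Sum>y\<leftarrow>xs. c) / real (length xs) = c"
    using assms(1) by (simp add: sum_list_triv)
  moreover have "(\<Sum>e\<in>(unit_steps :: (real ^ 'd) set). c) / (2 * real CARD('d)) = c"
    by (simp add: card_unit_steps)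
  ultimately show ?thesis
    by (subst step_mean_eq[OF assms]) (simp add: card_unit_steps algebra_simps)
qed

context elephant_random_walk
begin

definition follows :: "(real, 'd) vec list \<Rightarrow> 'w set" where
  "follows xs = {\<omega> \<in> space M. \<forall>i<length xs. \<sigma> (Suc i) \<omega> = xs ! i}"

definition hist_mean :: "nat \<Rightarrow> ((real, 'd) vec list \<Rightarrow> real) \<Rightarrow> real" where
  "hist_mean n \<phi> = (\<Sum>xs\<in>histories n. prob (follows xs) * \<phi> xs)"

lemma sets_follows: "follows xs \<in> events"
proof -
  have [measurable]: "\<sigma> (Suc i) \<in> borel_measurable M" for i
    by (rule step_measurable) simp
  show ?thesis unfolding follows_def by measurable
qed

lemma follows_eq: "follows xs = {\<omega> \<in> space M. \<forall>i\<in>{1..length xs}. \<sigma> i \<omega> = xs ! (i - 1)}"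
proof -
  have "(\<forall>i<length xs. \<sigma> (Suc i) \<omega> = xs ! i) \<longleftrightarrow> (\<forall>i\<in>{1..length xs}. \<sigma> i \<omega> = xs ! (i - 1))" for \<omega>
    unfolding image_Suc_lessThan[symmetric] by auto
  then show ?thesis unfolding follows_def by blast
qed

text \<open>
  The two rules of the walk are given as conditional probabilities, which are meaningful only
  on histories of positive probability.  As product formulas they hold for all histories.
\<close>

lemma prob_follows_memory:
  assumes "xs \<noteq> []" "k < length xs"
  shows "prob (follows xs \<inter> {\<omega> \<in> space M. \<nu> (length xs) \<omega> = Suc k}) = prob (follows xs) / real (length xs)"
proof (cases "prob (follows xs) = 0")
  case True
  then show ?thesis
    using finite_measure_mono[of "follows xs \<inter> {\<omega> \<in> space M. \<nu> (length xs) \<omega> = Suc k}" "follows xs"]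
    by (auto simp: sets_follows measure_le_0_iff)
next
  case False
  then have pos: "prob (follows xs) > 0"
    using measure_nonneg[of M "follows xs"] by linarith
  have "\<P>(\<omega> in M. \<nu> (length xs) \<omega> = Suc k \<bar> \<forall>i\<in>{1..length xs}. \<sigma> i \<omega> = xs ! (i - 1)) = 1 / real (length xs)"
    using assms pos by (intro memory) (auto simp: follows_eq Suc_le_eq)
  moreover have "{\<omega> \<in> space M. \<nu> (length xs) \<omega> = Suc k \<and> (\<forall>i\<in>{1..length xs}. \<sigma> i \<omega> = xs ! (i - 1))}
      = follows xs \<inter> {\<omega> \<in> space M. \<nu> (length xs) \<omega> = Suc k}"
    unfolding follows_eq by auto
  ultimately show ?thesis
    using False assms(1) unfolding cond_prob_def follows_eq[symmetric] by (simp add: field_simps)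
qed

lemma prob_follows_step:
  assumes "xs \<noteq> []" "k < length xs" "e \<in> unit_steps"
  shows "prob (follows xs \<inter> {\<omega> \<in> space M. \<nu> (length xs) \<omega> = Suc k} \<inter> {\<omega> \<in> space M. \<sigma> (Suc (length xs)) \<omega> = e})
    = prob (follows xs) / real (length xs) * (if e = xs ! k then p else (1 - p) / (2 * real CARD('d) - 1))"
    (is "prob (?F \<inter> ?N \<inter> ?E) = _")
proof -
  have [measurable]: "\<nu> (length xs) \<in> measurable M (count_space UNIV)"
    using assms(1) by (intro memory_measurable) (simp add: Suc_le_eq)
  have N: "?N \<in> events" by measurable
  have FN: "prob (?F \<inter> ?N) = prob (follows xs) / real (length xs)"
    using prob_follows_memory[OF assms(1,2)] .
  show ?thesis
  proof (cases "prob (follows xs) = 0")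
    case True
    then have "prob (?F \<inter> ?N \<inter> ?E) \<le> 0"
      using finite_measure_mono[of "?F \<inter> ?N \<inter> ?E" "?F"] sets_follows[of xs] by auto
    then show ?thesis using True by (simp add: measure_le_0_iff)
  next
    case False
    then have pos: "prob (?F \<inter> ?N) > 0"
      using FN assms measure_nonneg[of M "follows xs"] by (simp add: less_le)
    have eq: "?F \<inter> ?N = {\<omega> \<in> space M. (\<forall>i\<in>{1..length xs}. \<sigma> i \<omega> = xs ! (i - 1)) \<and> \<nu> (length xs) \<omega> = Suc k}"
      unfolding follows_eq by auto
    have "\<P>(\<omega> in M. \<sigma> (Suc (length xs)) \<omega> = e \<bar> (\<forall>i\<in>{1..length xs}. \<sigma> i \<omega> = xs ! (i - 1)) \<and> \<nu> (length xs) \<omega> = Suc k)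
        = (if e = xs ! (Suc k - 1) then p else (1 - p) / (2 * real CARD('d) - 1))"
      using assms pos unfolding eq by (intro step) (auto simp: Suc_le_eq)
    moreover have "{\<omega> \<in> space M. \<sigma> (Suc (length xs)) \<omega> = e \<and> (\<forall>i\<in>{1..length xs}. \<sigma> i \<omega> = xs ! (i - 1)) \<and> \<nu> (length xs) \<omega> = Suc k}
        = ?F \<inter> ?N \<inter> ?E"
      unfolding follows_eq by auto
    ultimately have "prob (?F \<inter> ?N \<inter> ?E) / prob (?F \<inter> ?N) = (if e = xs ! k then p else (1 - p) / (2 * real CARD('d) - 1))"
      unfolding cond_prob_def eq[symmetric] by simp
    moreover have "x = z * c" if "x / y = c" "y = z" "y > 0" for x y z c :: real
      using that by (auto simp: field_simps)
    ultimately show ?thesis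
      using pos FN by blast
  qed
qed

text \<open>
  By \<open>prob_follows_memory\<close> the events that the recalled instant is \<open>1, \<dots>, n\<close> exhaust the history
  up to a null set, so the probability of the next step is the average over the recalled instants.
\<close>

lemma prob_follows_snoc:
  assumes "xs \<noteq> []" "e \<in> unit_steps"
  shows "prob (follows (xs @ [e])) = prob (follows xs) * transition p xs e"
proof -
  let ?n = "length xs"
  define N where "N k = {\<omega> \<in> space M. \<nu> ?n \<omega> = Suc k}" for k
  define E where "E = {\<omega> \<in> space M. \<sigma> (Suc ?n) \<omega> = e}"
  have [measurable]: "\<nu> ?n \<in> measurable M (count_space UNIV)"
    using assms(1) by (intro memory_measurable) (simp add: Suc_le_eq)
  have [measurable]: "\<sigma> (Suc ?n) \<in> borel_measurable M"
    by (intro step_measurable) simp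
  have sets: "N k \<in> events" "E \<in> events" for k
    unfolding N_def E_def by measurable
  note [simp] = sets sets_follows
  have disj: "disjoint_family_on (\<lambda>k. X \<inter> N k) {..<?n}" for X
    by (auto simp: disjoint_family_on_def N_def)
  let ?U = "\<Union>k\<in>{..<?n}. follows xs \<inter> N k"
  have "prob ?U = (\<Sum>k<?n. prob (follows xs \<inter> N k))"
    by (intro finite_measure_finite_Union disj) auto
  also have "\<dots> = (\<Sum>k<?n. prob (follows xs) / real ?n)"
    using prob_follows_memory[OF assms(1)] by (intro sum.cong) (auto simp: N_def)
  also have "\<dots> = prob (follows xs)"
    using assms(1) by simp
  finally have full: "prob (follows xs - ?U) = 0"
    by (subst finite_measure_Diff) (auto intro!: sets.Int sets.finite_UN)
  have snoc: "follows (xs @ [e]) = follows xs \<inter> E"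
    unfolding follows_def E_def by (auto simp: nth_append less_Suc_eq)
  have "prob (follows xs \<inter> E) = prob (?U \<inter> E)"
  proof (rule antisym)
    have "prob (follows xs \<inter> E) \<le> prob ((?U \<inter> E) \<union> (follows xs - ?U))"
      by (rule finite_measure_mono) (auto intro!: sets.Int sets.Un sets.Diff sets.finite_UN)
    also have "\<dots> \<le> prob (?U \<inter> E) + prob (follows xs - ?U)"
      by (rule measure_Un_le) (auto intro!: sets.Int sets.Diff sets.finite_UN)
    finally show "prob (follows xs \<inter> E) \<le> prob (?U \<inter> E)" using full by simp
    show "prob (?U \<inter> E) \<le> prob (follows xs \<inter> E)"
      by (rule finite_measure_mono) auto
  qed
  also have "?U \<inter> E = (\<Union>k\<in>{..<?n}. (follows xs \<inter> E) \<inter> N k)" by auto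
  also have "prob \<dots> = (\<Sum>k<?n. prob ((follows xs \<inter> E) \<inter> N k))"
    by (intro finite_measure_finite_Union disj) (auto intro!: sets.Int)
  also have "\<dots> = (\<Sum>k<?n. prob (follows xs) / real ?n * (if e = xs ! k then p else (1 - p) / (2 * real CARD('d) - 1)))"
    using prob_follows_step[OF assms(1) _ assms(2)]
    by (intro sum.cong) (auto simp: N_def E_def Int_ac)
  also have "\<dots> = prob (follows xs) * transition p xs e"
    by (simp add: transition_def sum_list_sum_nth atLeast0LessThan sum_distrib_left sum_divide_distrib)
  finally show ?thesis by (simp add: snoc)
qed

lemma hist_mean_1: "hist_mean 1 \<phi> = \<phi> [axis 1 1]"
proof -
  have U: "axis 1 1 \<in> (unit_steps :: (real, 'd) vec set)" by (auto simp: unit_steps_def)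
  have hist: "histories 1 = (\<lambda>e. [e]) ` (unit_steps :: (real, 'd) vec set)"
    by (auto simp: histories_def length_Suc_conv)
  have one: "prob (follows [e]) = (if e = axis 1 1 then 1 else 0)" for e
  proof (cases "e = axis 1 1")
    case True
    then have "AE \<omega> in M. \<omega> \<in> follows [e]"
      using first_step by (auto simp: follows_def)
    then show ?thesis using True by (simp add: prob_eq_1 sets_follows)
  next
    case False
    then have "AE \<omega> in M. \<omega> \<notin> follows [e]"
      using first_step by (auto simp: follows_def)
    then show ?thesis using False by (simp add: prob_eq_0 sets_follows)
  qed
  have "hist_mean 1 \<phi> = (\<Sum>e\<in>unit_steps. (if e = axis 1 1 then 1 else 0) * \<phi> [e])"
    unfolding hist_mean_def hist by (subst sum.reindex) (auto simp: inj_on_def one)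
  then show ?thesis
    using U by (simp add: finite_unit_steps if_distrib[of "\<lambda>u. u * _"] sum.delta cong: if_cong)
qed

lemma hist_mean_Suc:
  assumes "n \<ge> 1"
  shows "hist_mean (Suc n) \<phi> = hist_mean n (\<lambda>xs. step_mean p xs (\<lambda>e. \<phi> (xs @ [e])))"
  unfolding hist_mean_def sum_histories_Suc step_mean_def sum_distrib_left
proof (intro sum.cong refl)
  fix xs :: "(real, 'd) vec list" and e :: "(real, 'd) vec" assume xs: "xs \<in> histories n" "e \<in> unit_steps"
  then have "xs \<noteq> []" using assms by (auto simp: histories_def)
  from prob_follows_snoc[OF this xs(2)]
  show "prob (follows (xs @ [e])) * \<phi> (xs @ [e]) = prob (follows xs) * (transition p xs e * \<phi> (xs @ [e]))"
    by simp
qed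

lemma hist_mean_mono:
  assumes "\<And>xs. xs \<in> histories n \<Longrightarrow> \<phi> xs \<le> \<psi> xs"
  shows "hist_mean n \<phi> \<le> hist_mean n \<psi>"
  unfolding hist_mean_def by (intro sum_mono mult_left_mono assms) auto

lemma hist_mean_add: "hist_mean n (\<lambda>xs. \<phi> xs + \<psi> xs) = hist_mean n \<phi> + hist_mean n \<psi>"
  by (simp add: hist_mean_def algebra_simps sum.distrib)

lemma hist_mean_cmult: "hist_mean n (\<lambda>xs. c * \<phi> xs) = c * hist_mean n \<phi>"
  by (simp add: hist_mean_def algebra_simps sum_distrib_left)

lemma hist_mean_const:
  assumes "n \<ge> 1"
  shows "hist_mean n (\<lambda>_. c) = c"
  using assms
proof (induction n rule: nat_induct_at_least)
  case base
  then show ?case using hist_mean_1 by simp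
next
  case (Suc n)
  have "hist_mean (Suc n) (\<lambda>_. c) = hist_mean n (\<lambda>xs. step_mean p xs (\<lambda>_. c))"
    by (rule hist_mean_Suc) fact
  also have "\<dots> = hist_mean n (\<lambda>_. c)"
    unfolding hist_mean_def
    using Suc.hyps by (intro sum.cong refl arg_cong2[of _ _ _ _ "(*)"] step_mean_const) (auto simp: histories_def)
  finally show ?case using Suc.IH by simp
qed

lemma walk_eq_sum_list:
  assumes "\<omega> \<in> follows xs" "m \<le> length xs"
  shows "S m \<omega> = sum_list (take m xs)"
  using assms(2)
proof (induction m)
  case 0
  then show ?case using assms walk_0 by (auto simp: follows_def)
next
  case (Suc m)
  then have "\<sigma> (Suc m) \<omega> = xs ! m" "\<omega> \<in> space M"
    using assms by (auto simp: follows_def)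
  with Suc show ?case
    by (simp add: walk_Suc take_Suc_conv_app_nth)
qed

text \<open>
  The lists over the unit steps carry total mass 1, so the outcomes that follow none of them form a
  null set.
\<close>

lemma prob_le_hist_mean:
  assumes "n \<ge> 1" and "\<And>xs \<omega>. xs \<in> histories n \<Longrightarrow> \<omega> \<in> follows xs \<Longrightarrow> \<omega> \<in> A \<Longrightarrow> P xs"
    and A: "A \<in> events"
  shows "prob A \<le> hist_mean n (\<lambda>xs. of_bool (P xs))"
proof -
  let ?H = "\<Union>xs\<in>histories n. follows xs"
  have disj: "disjoint_family_on follows (histories n)"
  proof (unfold disjoint_family_on_def, intro ballI impI)
    fix xs ys :: "(real, 'd) vec list" assume "xs \<in> histories n" "ys \<in> histories n" "xs \<noteq> ys"
    then show "follows xs \<inter> follows ys = {}"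
      by (auto simp: follows_def histories_def list_eq_iff_nth_eq)
  qed
  note [simp] = sets_follows finite_histories A
  have H: "?H \<in> events" by (intro sets.finite_UN) auto
  have "prob ?H = (\<Sum>xs\<in>histories n. prob (follows xs))"
    by (intro finite_measure_finite_Union disj) auto
  also have "\<dots> = hist_mean n (\<lambda>_. 1)" by (simp add: hist_mean_def)
  finally have "prob ?H = 1" using hist_mean_const[OF assms(1)] by simp
  then have null: "prob (space M - ?H) = 0" using H by (simp add: prob_compl)
  let ?P = "{xs \<in> histories n. P xs}"
  have "A \<subseteq> space M" by (rule sets.sets_into_space) simp
  then have "A \<subseteq> (\<Union>xs\<in>?P. follows xs) \<union> (space M - ?H)"
    using assms(2) by blast
  then have "prob A \<le> prob ((\<Union>xs\<in>?P. follows xs) \<union> (space M - ?H))"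
    using H by (intro finite_measure_mono sets.Un sets.finite_UN) auto
  also have "\<dots> \<le> prob (\<Union>xs\<in>?P. follows xs) + prob (space M - ?H)"
    using H by (intro measure_Un_le sets.finite_UN) auto
  also have "prob (\<Union>xs\<in>?P. follows xs) \<le> (\<Sum>xs\<in>?P. prob (follows xs))"
    by (intro finite_measure_subadditive_finite) auto
  also have "(\<Sum>xs\<in>?P. prob (follows xs)) = hist_mean n (\<lambda>xs. of_bool (P xs))"
    unfolding hist_mean_def by (rule sum.mono_neutral_cong_left) auto
  finally show ?thesis using null by simp
qed

end

section \<open>One step of the planar walk\<close>

text \<open>
  The second-order term must be exact, as it cancels the harmonic part; the cubic remainder holds on
  the whole domain of the logarithm because the derivative of the difference of the two sides is
  \<open>u ^ 3 / (1 + u)\<close>, which has the sign of \<open>u\<close>.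
\<close>

lemma ln_add_one_le_cubic:
  fixes u :: real
  assumes "u > -1"
  shows "ln (1 + u) \<le> u - u\<^sup>2 / 2 + u ^ 3 / 3"
proof -
  define \<phi> where "\<phi> x = x - x\<^sup>2 / 2 + x ^ 3 / 3 - ln (1 + x)" for x :: real
  have deriv: "(\<phi> has_real_derivative x ^ 3 / (1 + x)) (at x)" if "x > -1" for x
    unfolding \<phi>_def using that
    by (auto intro!: derivative_eq_intros simp: field_simps power2_eq_square power3_eq_cube)
  have "\<phi> 0 \<le> \<phi> u"
  proof (cases "u \<ge> 0")
    case True
    show ?thesis
    proof (rule DERIV_nonneg_imp_nondecreasing[OF True])
      fix x assume "0 \<le> x" "x \<le> u"
      then show "\<exists>y. (\<phi> has_real_derivative y) (at x) \<and> 0 \<le> y"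
        using deriv[of x] by (intro exI[of _ "x ^ 3 / (1 + x)"]) auto
    qed
  next
    case False
    then have "u \<le> 0" by simp
    then show ?thesis
    proof (rule DERIV_nonpos_imp_nonincreasing)
      fix x assume "u \<le> x" "x \<le> 0"
      then have "x ^ 3 \<le> 0" "x > -1"
        using assms by (auto simp: power3_eq_cube mult_nonneg_nonpos)
      then show "\<exists>y. (\<phi> has_real_derivative y) (at x) \<and> y \<le> 0"
        using deriv[of x] by (intro exI[of _ "x ^ 3 / (1 + x)"]) (auto simp: divide_nonpos_pos)
    qed
  qed
  then show ?thesis by (simp add: \<phi>_def)
qed

definition imbalance :: "(real ^ 2) list \<Rightarrow> real" where
  "imbalance xs = (\<Sum>e\<leftarrow>xs. (e $ 1)\<^sup>2 - (e $ 2)\<^sup>2)"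

lemma norm_square_2: "(norm (v :: real ^ 2))\<^sup>2 = (v $ 1)\<^sup>2 + (v $ 2)\<^sup>2"
  by (simp add: norm_vec_def L2_set_def sum_2)

lemma unit_steps_2: "(unit_steps :: (real ^ 2) set) = {axis 1 1, - axis 1 1, axis 2 1, - axis 2 1}"
  unfolding unit_steps_def UNIV_2 by auto

lemma unit_step_coordinates:
  fixes e :: "real ^ 2"
  assumes "e \<in> unit_steps"
  shows "\<bar>e $ 1\<bar> = 1 \<and> e $ 2 = 0 \<or> e $ 1 = 0 \<and> \<bar>e $ 2\<bar> = 1"
  using assms unfolding unit_steps_2 by (auto simp: axis_def)

lemma sum_unit_steps_2:
  fixes g :: "real ^ 2 \<Rightarrow> real"
  shows "(\<Sum>e\<in>unit_steps. g e) = g (axis 1 1) + g (- axis 1 1) + g (axis 2 1) + g (- axis 2 1)"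
proof -
  have "distinct [axis 1 1, - axis 1 1, axis 2 1, - axis 2 1 :: real ^ 2]"
    by (auto simp: vec_eq_iff axis_def forall_2)
  from sum_list_distinct_conv_sum_set[OF this, of g] show ?thesis
    unfolding unit_steps_2 by (simp add: add.assoc)
qed

text \<open>
  On the four unit steps every polynomial in the coordinates is a combination of \<open>1\<close>, the two
  coordinates and the difference of their squares, and the last three have mean 0 under the uniform
  distribution.  A conditional mean therefore involves the past only through the position and the
  imbalance.
\<close>

lemma step_mean_affine:
  fixes xs :: "(real ^ 2) list"
  assumes "xs \<noteq> []" "set xs \<subseteq> unit_steps"
    and "\<And>e. e \<in> unit_steps \<Longrightarrow> g e = A + B * e $ 1 + C * e $ 2 + D * ((e $ 1)\<^sup>2 - (e $ 2)\<^sup>2)"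
  shows "step_mean p xs g = A + (4 * p - 1) / 3 / real (length xs) *
           (B * sum_list xs $ 1 + C * sum_list xs $ 2 + D * imbalance xs)"
proof -
  let ?g = "\<lambda>e::real ^ 2. A + B * e $ 1 + C * e $ 2 + D * ((e $ 1)\<^sup>2 - (e $ 2)\<^sup>2)"
  have "step_mean p xs g = step_mean p xs ?g"
    unfolding step_mean_def using assms(3) by (intro sum.cong refl) simp
  moreover define T where "T = B * sum_list xs $ 1 + C * sum_list xs $ 2 + D * imbalance xs"
  moreover have "(\<Sum>y\<leftarrow>xs. ?g y) = A * real (length xs) + T"
    unfolding T_def by (induction xs) (simp_all add: imbalance_def algebra_simps)
  moreover have "(\<Sum>e\<in>unit_steps. ?g e) = 4 * A"
    unfolding sum_unit_steps_2 by (simp add: axis_def)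
  ultimately show ?thesis
    using assms(1) step_mean_eq[OF assms(1,2), of p ?g] by (simp add: field_simps)
qed

text \<open>
  Write \<open>R\<close> for the square of the distance from the origin and \<open>W = R - K\<close>.  A step \<open>e\<close> changes \<open>R\<close> by \<open>h\<close>, which is 1 plus
  twice the inner product of the position with \<open>e\<close>.  In the cubic expansion of \<open>ln (W + h)\<close>, an unbiased and isotropic step
  would contribute \<open>1 / W - R / W\<^sup>2 = - K / W\<^sup>2\<close> to leading order.  This negative term absorbs the cubic remainder
  of order \<open>1 / W\<^sup>2\<close>; half of it absorbs the anisotropy, at the price of the summand with the squared
  imbalance.  The drift yields \<open>2 a / n\<close> and a small correction.
\<close>

lemma step_mean_log_le:
  fixes xs :: "(real ^ 2) list" and K p :: real
  assumes xs: "xs \<noteq> []" "set xs \<subseteq> unit_steps" and p: "0 \<le> p" "p \<le> 1"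
    and K: "K \<ge> 10" and far: "(norm (sum_list xs))\<^sup>2 \<ge> 2 * K"
  defines "a \<equiv> (4 * p - 1) / 3" and "n \<equiv> real (length xs)" and "W \<equiv> (norm (sum_list xs))\<^sup>2 - K"
  shows "step_mean p xs (\<lambda>e. ln ((norm (sum_list xs + e))\<^sup>2 - K))
    \<le> ln W + 2 * a / n + (2 * K + 19) / (n * W) + 5 * (imbalance xs)\<^sup>2 / (K * n\<^sup>2)"
proof -
  define x y D where "x = sum_list xs $ 1" and "y = sum_list xs $ 2" and "D = imbalance xs"
  define R where "R = x\<^sup>2 + y\<^sup>2"
  have R: "R = (norm (sum_list xs))\<^sup>2" by (simp add: R_def x_def y_def norm_square_2)
  have W: "W = R - K" "W \<ge> 10" "R \<le> 2 * W" "R \<ge> 20" "R \<ge> 0"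
    using K far by (auto simp: W_def R)
  have n: "n \<ge> 1" using xs(1) by (simp add: n_def Suc_le_eq)
  have a: "\<bar>a\<bar> \<le> 1" using p by (simp add: a_def)
  \<comment> \<open>the coefficients of the cubic expansion in the form required by \<open>step_mean_affine\<close>\<close>
  define A where "A = ln W + 1 / W - (2 * R + 1) / (2 * W\<^sup>2) + (6 * R + 1) / (3 * W ^ 3)"
  define B where "B z = 2 * z / W - 4 * z / (2 * W\<^sup>2) + (8 * z ^ 3 + 6 * z) / (3 * W ^ 3)" for z
  define E where "E = (x\<^sup>2 - y\<^sup>2) * (2 / W ^ 3 - 1 / W\<^sup>2)"
  let ?g = "\<lambda>e::real ^ 2. A + B x * e $ 1 + B y * e $ 2 + E * ((e $ 1)\<^sup>2 - (e $ 2)\<^sup>2)"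
  have "step_mean p xs (\<lambda>e. ln ((norm (sum_list xs + e))\<^sup>2 - K)) \<le> step_mean p xs ?g"
  proof (rule step_mean_mono[OF p])
    fix e :: "real ^ 2" assume e: "e \<in> unit_steps"
    define h where "h = 2 * (x * e $ 1 + y * e $ 2) + 1"
    have e12: "\<bar>e $ 1\<bar> = 1 \<and> e $ 2 = 0 \<or> e $ 1 = 0 \<and> \<bar>e $ 2\<bar> = 1"
      by (rule unit_step_coordinates[OF e])
    have "norm (sum_list xs + e) \<ge> norm (sum_list xs) - 1"
      using norm_unit_step[OF e] norm_triangle_ineq4[of "sum_list xs + e" e] by simp
    moreover define r where "r = norm (sum_list xs)"
    moreover have r: "r\<^sup>2 = R" "r \<ge> 0" by (simp_all add: R r_def)
    moreover have "r \<ge> 4"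
      by (rule power2_le_imp_le) (use r W in auto)
    ultimately have "(norm (sum_list xs + e))\<^sup>2 \<ge> (r - 1)\<^sup>2"
      by (intro power_mono) auto
    moreover have "(r - 1)\<^sup>2 > R / 2"
    proof -
      have "r * r \<ge> 4 * r" using \<open>r \<ge> 4\<close> by (intro mult_right_mono) auto
      then show ?thesis unfolding r(1)[symmetric] by (simp add: power2_eq_square algebra_simps)
    qed
    moreover have "(norm (sum_list xs + e))\<^sup>2 = R + h"
      unfolding norm_square_2 vector_add_component x_def[symmetric] y_def[symmetric] R_def h_def
      using e12 by (auto simp: power2_eq_square algebra_simps abs_if split: if_splits)
    ultimately have Wh: "(norm (sum_list xs + e))\<^sup>2 - K = W + h" "W + h > 0"
      using W far unfolding R[symmetric] by auto
    have "h / W > -1" using Wh W by (simp add: field_simps)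
    have "ln (W + h) \<le> ln W + (h / W - (h / W)\<^sup>2 / 2 + (h / W) ^ 3 / 3)"
    proof -
      have "W + h = W * (1 + h / W)" using W by (simp add: field_simps)
      then have "ln (W + h) = ln W + ln (1 + h / W)"
        using W \<open>h / W > -1\<close> by (simp only: ln_mult_pos)
      then show ?thesis using ln_add_one_le_cubic[OF \<open>h / W > -1\<close>] by simp
    qed
    also have "\<dots> = ln W + h / W - h\<^sup>2 / (2 * W\<^sup>2) + h ^ 3 / (3 * W ^ 3)"
      by (simp add: power_divide)
    also have "\<dots> = ?g e"
    proof -
      let ?d = "(e $ 1)\<^sup>2 - (e $ 2)\<^sup>2"
      have 1: "h = 1 + 2 * x * e $ 1 + 2 * y * e $ 2" by (simp add: h_def)
      have 2: "h\<^sup>2 = (2 * R + 1) + 4 * x * e $ 1 + 4 * y * e $ 2 + 2 * (x\<^sup>2 - y\<^sup>2) * ?d"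
        unfolding h_def R_def using e12
        by (auto simp: power2_eq_square algebra_simps abs_if split: if_splits)
      have 3: "h ^ 3 = (6 * R + 1) + (8 * x ^ 3 + 6 * x) * e $ 1 + (8 * y ^ 3 + 6 * y) * e $ 2
          + 6 * (x\<^sup>2 - y\<^sup>2) * ?d"
        unfolding h_def R_def using e12
        by (auto simp: power2_eq_square power3_eq_cube algebra_simps abs_if split: if_splits)
      show ?thesis
        unfolding 2 3 A_def B_def E_def using W
        by (subst 1) (simp add: add_divide_distrib diff_divide_distrib algebra_simps)
    qed
    finally show "ln ((norm (sum_list xs + e))\<^sup>2 - K) \<le> ?g e" by (simp add: Wh)
  qed
  also have "\<dots> = A + a / n * (B x * x + B y * y + E * D)"
    unfolding a_def n_def x_def y_def D_def by (rule step_mean_affine[OF xs]) (rule refl)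
  also have "\<dots> = A + a / n * (B x * x + B y * y) + a / n * (E * D)"
    by (simp add: algebra_simps)
  \<comment> \<open>the three summands are the isotropic part, the drift and the anisotropy\<close>
  also have "A \<le> ln W + (5 - K) / W\<^sup>2"
  proof -
    have "R = W + K" using W by simp
    then have "1 / W - (2 * R + 1) / (2 * W\<^sup>2) = - K / W\<^sup>2 - 1 / (2 * W\<^sup>2)"
      using W(2) by (simp add: add_divide_distrib power2_eq_square)
    then have "1 / W - (2 * R + 1) / (2 * W\<^sup>2) \<le> - K / W\<^sup>2"
      by simp
    moreover have "(6 * R + 1) / (3 * W ^ 3) \<le> (15 * W) / (3 * W ^ 3)"
      using W by (intro divide_right_mono) auto
    moreover have "(15 * W) / (3 * W ^ 3) = 5 / W\<^sup>2"
      using W(2) by (simp add: power2_eq_square power3_eq_cube)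
    ultimately show ?thesis by (simp add: A_def diff_divide_distrib)
  qed
  also have "a / n * (B x * x + B y * y) \<le> 2 * a / n + (2 * K + 19) / (n * W)"
  proof -
    have "B x * x + B y * y = 2 * R / W - 2 * R / W\<^sup>2 + (8 * (x ^ 4 + y ^ 4) + 6 * R) / (3 * W ^ 3)"
      unfolding B_def R_def
      by (simp add: add_divide_distrib diff_divide_distrib algebra_simps power2_eq_square power3_eq_cube power4_eq_xxxx)
    also have "2 * R / W = 2 + 2 * K / W" using W by (simp add: field_simps)
    finally have "B x * x + B y * y = 2 + 2 * K / W - 2 * R / W\<^sup>2 + (8 * (x ^ 4 + y ^ 4) + 6 * R) / (3 * W ^ 3)" .
    then have eq: "a * (B x * x + B y * y) = a * 2 + a * (2 * K / W) - a * (2 * R / W\<^sup>2)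
        + a * ((8 * (x ^ 4 + y ^ 4) + 6 * R) / (3 * W ^ 3))"
      by (simp only: distrib_left right_diff_distrib)
    have abs: "a * t \<le> t" "- (a * t) \<le> t" if "t \<ge> 0" for t
      using a that mult_right_mono[of a 1 t] mult_right_mono[of "- a" 1 t] by auto
    have "a * (2 * K / W) \<le> 2 * K / W" using W K by (intro abs) auto
    moreover have "- (a * (2 * R / W\<^sup>2)) \<le> 4 / W"
    proof -
      have "- (a * (2 * R / W\<^sup>2)) \<le> 2 * R / W\<^sup>2" using W by (intro abs) auto
      also have "\<dots> \<le> 4 * W / W\<^sup>2" using W by (intro divide_right_mono) auto
      finally show ?thesis using W(2) by (simp add: power2_eq_square)
    qed
    moreover have "a * ((8 * (x ^ 4 + y ^ 4) + 6 * R) / (3 * W ^ 3)) \<le> 15 / W"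
    proof -
      have "a * ((8 * (x ^ 4 + y ^ 4) + 6 * R) / (3 * W ^ 3)) \<le> (8 * (x ^ 4 + y ^ 4) + 6 * R) / (3 * W ^ 3)"
        using W by (intro abs) auto
      also have "\<dots> \<le> 45 * W\<^sup>2 / (3 * W ^ 3)"
      proof (rule divide_right_mono)
        have "R\<^sup>2 = x ^ 4 + y ^ 4 + 2 * (x * y)\<^sup>2"
          unfolding R_def by (simp add: power2_eq_square power4_eq_xxxx algebra_simps)
        then have "x ^ 4 + y ^ 4 \<le> R\<^sup>2" by simp
        also have "\<dots> \<le> (2 * W)\<^sup>2" using W by (intro power_mono) auto
        finally have "x ^ 4 + y ^ 4 \<le> 4 * W\<^sup>2" by (simp add: power2_eq_square)
        moreover have "6 * R \<le> 12 * W" using W(3) by simp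
        moreover have "10 * W \<le> W\<^sup>2" using W(2) by (simp add: power2_eq_square)
        ultimately show "8 * (x ^ 4 + y ^ 4) + 6 * R \<le> 45 * W\<^sup>2" using W by simp
      qed (use W in auto)
      also have "\<dots> = 15 / W" using W(2) by (simp add: power2_eq_square power3_eq_cube)
      finally show ?thesis .
    qed
    ultimately have "a * (B x * x + B y * y) \<le> 2 * a + 2 * K / W + 4 / W + 15 / W"
      unfolding eq by linarith
    also have "\<dots> = 2 * a + (2 * K + 19) / W" by (simp add: add_divide_distrib)
    finally have "a * (B x * x + B y * y) / n \<le> (2 * a + (2 * K + 19) / W) / n"
      using n by (intro divide_right_mono) auto
    then show ?thesis by (simp add: add_divide_distrib mult.commute)
  qed
  also have "a / n * (E * D) \<le> K / 2 / W\<^sup>2 + 5 * D\<^sup>2 / (K * n\<^sup>2)"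
  proof -
    have E: "\<bar>E\<bar> \<le> 3 / W"
    proof -
      have "\<bar>x\<^sup>2 - y\<^sup>2\<bar> \<le> 2 * W" using W(3) zero_le_power2[of x] zero_le_power2[of y]
        unfolding R_def abs_le_iff by linarith
      moreover have "\<bar>2 / W ^ 3 - 1 / W\<^sup>2\<bar> \<le> 1 / W\<^sup>2"
        using W by (simp add: abs_le_iff field_simps power2_eq_square power3_eq_cube)
      ultimately have "\<bar>E\<bar> \<le> 2 * W * (1 / W\<^sup>2)"
        unfolding E_def abs_mult using W by (intro mult_mono) auto
      also have "\<dots> \<le> 3 / W" using W(2) by (simp add: power2_eq_square field_simps)
      finally show ?thesis .
    qed
    define t where "t = \<bar>D\<bar> / n"
    have "a / n * (E * D) \<le> \<bar>a\<bar> * (\<bar>E\<bar> * t)"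
      using n abs_ge_self[of "a / n * (E * D)"] by (simp add: t_def abs_mult)
    also have "\<dots> \<le> 1 * (\<bar>E\<bar> * t)"
      using a n by (intro mult_right_mono) (auto simp: t_def)
    also have "\<dots> \<le> 3 / W * t"
      using mult_right_mono[OF E, of t] n by (simp add: t_def)
    also have "3 / W * t \<le> K / 2 / W\<^sup>2 + 5 * t\<^sup>2 / K"
    proof -
      \<comment> \<open>arithmetic and geometric means, weighted so that \<open>1 / W\<^sup>2\<close> costs half of the gain \<open>K / W\<^sup>2\<close>\<close>
      have "0 \<le> (K / W - 3 * t)\<^sup>2 / (2 * K)" using K by simp
      also have "\<dots> = K / 2 / W\<^sup>2 + 9 / 2 * t\<^sup>2 / K - 3 / W * t"
        using K W by (simp add: power2_eq_square field_simps)
      finally have "3 / W * t \<le> K / 2 / W\<^sup>2 + 9 / 2 * t\<^sup>2 / K" by simp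
      moreover have "9 / 2 * t\<^sup>2 / K \<le> 5 * t\<^sup>2 / K"
        using K by (intro divide_right_mono) auto
      ultimately show ?thesis by linarith
    qed
    also have "5 * t\<^sup>2 / K = 5 * D\<^sup>2 / (K * n\<^sup>2)"
      by (simp add: t_def power_divide mult.commute)
    finally show ?thesis .
  qed
  finally have "step_mean p xs (\<lambda>e. ln ((norm (sum_list xs + e))\<^sup>2 - K))
    \<le> ln W + 2 * a / n + (2 * K + 19) / (n * W) + 5 * D\<^sup>2 / (K * n\<^sup>2) + ((5 - K) / W\<^sup>2 + K / 2 / W\<^sup>2)"
    by simp
  also have "(5 - K) / W\<^sup>2 + K / 2 / W\<^sup>2 = ((5 - K) + K / 2) / W\<^sup>2"
    by (rule add_divide_distrib[symmetric])
  also have "\<dots> \<le> 0" using K by (simp add: divide_nonpos_nonneg)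
  finally show ?thesis by (simp add: D_def)
qed

section \<open>Frequent returns below the power curve\<close>

lemma one_over_le_ln_increment:
  assumes "n \<ge> 1"
  shows "1 / (real n + 1) \<le> ln (real (Suc n)) - ln (real n)"
proof -
  have "ln (real n / (real n + 1)) \<le> real n / (real n + 1) - 1"
    using assms by (intro ln_le_minus_one) auto
  also have "\<dots> = - 1 / (real n + 1)" by (simp add: field_simps)
  finally show ?thesis
    using assms by (simp add: ln_div add.commute)
qed

lemma imbalance_snoc_square:
  assumes "e \<in> unit_steps"
  shows "(imbalance (xs @ [e]))\<^sup>2
    = (imbalance xs)\<^sup>2 + 1 + 2 * imbalance xs * ((e $ 1)\<^sup>2 - (e $ 2)\<^sup>2)"
  using unit_step_coordinates[OF assms]
  by (auto simp: imbalance_def power2_eq_square algebra_simps abs_if split: if_splits)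

definition stays_outside :: "real \<Rightarrow> nat \<Rightarrow> (real ^ 2) list \<Rightarrow> bool" where
  "stays_outside s N xs \<longleftrightarrow> (\<forall>m\<in>{N..length xs}. real m powr s < norm (sum_list (take m xs)))"

lemma stays_outside_snocD: "stays_outside s N (xs @ [e]) \<Longrightarrow> stays_outside s N xs"
  unfolding stays_outside_def
proof (intro ballI)
  fix m assume "\<forall>m\<in>{N..length (xs @ [e])}. real m powr s < norm (sum_list (take m (xs @ [e])))"
    and "m \<in> {N..length xs}"
  then show "real m powr s < norm (sum_list (take m xs))"
    by (force dest: bspec[of _ _ m])
qed

lemma stays_outside_square:
  assumes "stays_outside s N xs" "N \<le> length xs"
  shows "real (length xs) powr (2 * s) \<le> (norm (sum_list xs))\<^sup>2"
proof -
  have "real (length xs) powr s < norm (sum_list xs)"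
    using assms(1)[unfolded stays_outside_def, rule_format, of "length xs"] assms(2) by simp
  then have "(real (length xs) powr s)\<^sup>2 \<le> (norm (sum_list xs))\<^sup>2"
    by (intro power_mono) auto
  then show ?thesis by (simp add: power2_eq_square flip: powr_add)
qed

definition potential :: "real \<Rightarrow> real \<Rightarrow> (real ^ 2) list \<Rightarrow> real" where
  "potential K b xs = ln ((norm (sum_list xs))\<^sup>2 - K) - 2 * b * ln (real (length xs))"

text \<open>
  The bound \<open>a < 1/2\<close> is the diffusive regime \<open>p < 5/8\<close>.
\<close>

locale planar_elephant_random_walk = elephant_random_walk M p S \<sigma> \<nu>
  for M :: "'w measure" and p :: real and S \<sigma> :: "nat \<Rightarrow> 'w \<Rightarrow> real ^ 2"
    and \<nu> :: "nat \<Rightarrow> 'w \<Rightarrow> nat" +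
  fixes a :: real
  defines "a \<equiv> (4 * p - 1) / 3"
  assumes diffusive: "a < 1 / 2"
begin

text \<open>
  Since the conditional mean of the next increment of the imbalance \<open>D\<close> is \<open>a D / n\<close>, the mean of
  \<open>D\<^sup>2\<close> at time \<open>n\<close> is multiplied by \<open>1 + 2 a / n\<close> and increased by 1.  If \<open>2 a \<le> c\<close> and
  \<open>0 \<le> c < 1\<close>, the function \<open>n / (1 - c)\<close> solves the recursion with \<open>c\<close> in place of \<open>2 a\<close> and dominates.
\<close>

lemma imbalance_second_moment:
  obtains C where "C > 0" "\<And>n. n \<ge> 1 \<Longrightarrow> hist_mean n (\<lambda>xs. (imbalance xs)\<^sup>2) \<le> C * real n"
proof
  define c where "c = max 0 (2 * a)"
  define C where "C = 1 / (1 - c)"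
  have c: "0 \<le> c" "c < 1" "2 * a \<le> c" using diffusive by (auto simp: c_def)
  then show "C > 0" by (simp add: C_def)
  have C: "C = c * C + 1" "C \<ge> 1" using c by (simp_all add: C_def field_simps)
  show "hist_mean n (\<lambda>xs. (imbalance xs)\<^sup>2) \<le> C * real n" if "n \<ge> 1" for n
    using that
  proof (induction n rule: nat_induct_at_least)
    case base
    then show ?case using C(2) hist_mean_1 by (simp add: imbalance_def axis_def)
  next
    case (Suc n)
    let ?D = "\<lambda>xs. (imbalance xs)\<^sup>2"
    have step: "step_mean p xs (\<lambda>e. ?D (xs @ [e])) \<le> (1 + c / real n) * ?D xs + 1"
      if xs: "xs \<in> histories n" for xs
    proof -
      have ne: "xs \<noteq> []" "set xs \<subseteq> unit_steps" "length xs = n"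
        using xs Suc.hyps by (auto simp: histories_def)
      have "step_mean p xs (\<lambda>e. ?D (xs @ [e]))
          = ?D xs + 1 + (4 * p - 1) / 3 / real (length xs) *
            (0 * sum_list xs $ 1 + 0 * sum_list xs $ 2 + 2 * imbalance xs * imbalance xs)"
        by (rule step_mean_affine[OF ne(1,2)]) (simp add: imbalance_snoc_square)
      also have "\<dots> = ?D xs + 1 + 2 * a / real n * ?D xs"
        by (simp add: a_def ne power2_eq_square)
      also have "2 * a / real n * ?D xs \<le> c / real n * ?D xs"
        using c by (intro mult_right_mono divide_right_mono) auto
      finally show ?thesis by (simp add: algebra_simps)
    qed
    have "hist_mean (Suc n) ?D = hist_mean n (\<lambda>xs. step_mean p xs (\<lambda>e. ?D (xs @ [e])))"
      by (rule hist_mean_Suc) fact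
    also have "\<dots> \<le> hist_mean n (\<lambda>xs. (1 + c / real n) * ?D xs + 1)"
      by (intro hist_mean_mono step)
    also have "\<dots> = (1 + c / real n) * hist_mean n ?D + 1"
      using Suc.hyps by (simp add: hist_mean_add hist_mean_cmult hist_mean_const)
    also have "\<dots> \<le> (1 + c / real n) * (C * real n) + 1"
      using Suc.IH c by (intro add_right_mono mult_left_mono) auto
    also have "\<dots> = C * real n + (c * C + 1)"
      using Suc.hyps by (simp add: field_simps)
    also have "\<dots> = C * real (Suc n)"
      unfolding C(1)[symmetric] by (simp add: algebra_simps)
    finally show ?case .
  qed
qed

text \<open>
  The difference between \<open>b\<close> and \<open>a\<close> absorbs the terms of order \<open>o(1/n)\<close> in \<open>step_mean_log_le\<close>, which leaves the
  imbalance as the only error.  The difference between \<open>s\<close> and \<open>b\<close> keeps the potential nonnegative even at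
  the step that crosses the curve; this permits dropping the crossing paths from the expectation.
\<close>

lemma potential_step:
  assumes b: "a < b" "0 < b" "b < s" and K: "K \<ge> 16"
  shows "\<forall>\<^sub>F n in sequentially. \<forall>N\<le>n. \<forall>xs\<in>histories n. stays_outside s N xs \<longrightarrow>
     2 * (s - b) * ln (real n) - ln 2 \<le> potential K b xs \<and>
     (\<forall>e\<in>unit_steps. 0 \<le> potential K b (xs @ [e])) \<and>
     step_mean p xs (\<lambda>e. potential K b (xs @ [e]))
       \<le> potential K b xs + 5 / (K * real n ^ 2) * (imbalance xs)\<^sup>2"
proof -
  have s: "0 < s" using b by simp
  then have "filterlim (\<lambda>n. real n powr (2 * s)) at_top sequentially" by real_asymp
  then have 1: "\<forall>\<^sub>F n in sequentially. 4 * K \<le> real n powr (2 * s)"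
    unfolding filterlim_at_top by blast
  have 2: "\<forall>\<^sub>F n in sequentially. 2 * real (Suc n) powr (2 * b) \<le> real n powr (2 * s)"
  proof -
    have "filterlim (\<lambda>n. real n powr t) at_top sequentially" if "t > 0" for t
      using that by real_asymp
    from this[of "2 * s - 2 * b"] have "\<forall>\<^sub>F n in sequentially. 2 * 2 powr (2 * b) \<le> real n powr (2 * s - 2 * b)"
      using b unfolding filterlim_at_top by auto
    with eventually_ge_at_top[of 1] show ?thesis
    proof eventually_elim
      case (elim n)
      have "2 * real (Suc n) powr (2 * b) \<le> 2 * (2 * real n) powr (2 * b)"
        using elim b by (intro mult_left_mono powr_mono2) auto
      also have "\<dots> = 2 * 2 powr (2 * b) * real n powr (2 * b)"
        by (simp add: powr_mult)
      also have "\<dots> \<le> real n powr (2 * s - 2 * b) * real n powr (2 * b)"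
        by (intro mult_right_mono elim) auto
      also have "\<dots> = real n powr (2 * s)" by (simp flip: powr_add)
      finally show ?case .
    qed
  qed
  have lim1: "(\<lambda>n. real n powr (- 2 * s)) \<longlonglongrightarrow> 0" using s by real_asymp
  have lim2: "(\<lambda>n. real n / (real n + 1)) \<longlonglongrightarrow> 1" by real_asymp
  have "((\<lambda>n. 2 * a + (2 * K + 19) * 2 * real n powr (- 2 * s) - 2 * b * (real n / (real n + 1)))
      \<longlongrightarrow> 2 * a + (2 * K + 19) * 2 * 0 - 2 * b * 1) sequentially"
    by (intro tendsto_intros lim1 lim2)
  then have 3: "\<forall>\<^sub>F n in sequentially. 2 * a + (2 * K + 19) * 2 * real n powr (- 2 * s)
      - 2 * b * (real n / (real n + 1)) < 0"
    using b by (intro order_tendstoD(2)) auto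
  from 1 2 3 eventually_ge_at_top[of 1] show ?thesis
  proof (eventually_elim, intro allI ballI impI)
    fix n N xs
    assume n1: "4 * K \<le> real n powr (2 * s)" and n2: "2 * real (Suc n) powr (2 * b) \<le> real n powr (2 * s)"
      and n3: "2 * a + (2 * K + 19) * 2 * real n powr (- 2 * s) - 2 * b * (real n / (real n + 1)) < 0"
      and n: "1 \<le> n" "N \<le> n" and xs: "xs \<in> histories n" and out: "stays_outside s N xs"
    have ne: "xs \<noteq> []" "set xs \<subseteq> unit_steps" "length xs = n"
      using xs n by (auto simp: histories_def)
    define r where "r = norm (sum_list xs)"
    define W where "W = r\<^sup>2 - K"
    have r: "real n powr (2 * s) \<le> r\<^sup>2" "r \<ge> 0"
      using stays_outside_square[OF out] n ne by (auto simp: r_def)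
    have r4K: "r\<^sup>2 \<ge> 4 * K" using r n1 by simp
    have r8: "r \<ge> 8" by (rule power2_le_imp_le) (use r r4K K in auto)
    have W: "W \<ge> real n powr (2 * s) / 2" "W > 0"
      using r r4K K n by (auto simp: W_def)
    have npos: "real n powr (2 * s) > 0" using n by simp
    have "2 * s * ln (real n) - ln 2 = ln (real n powr (2 * s) / 2)"
      using n by (simp add: ln_div ln_powr)
    also have "\<dots> \<le> ln W" using W npos by (intro ln_mono) auto
    finally have low: "2 * (s - b) * ln (real n) - ln 2 \<le> potential K b xs"
      by (simp add: potential_def ne W_def r_def algebra_simps)
    have nonneg: "0 \<le> potential K b (xs @ [e])" if e: "e \<in> unit_steps" for e
    proof -
      have "norm (sum_list xs + e) \<ge> r - 1"
        using norm_unit_step[OF e] norm_triangle_ineq4[of "sum_list xs + e" e] by (simp add: r_def)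
      then have "(norm (sum_list xs + e))\<^sup>2 \<ge> (r - 1)\<^sup>2"
        using r8 by (intro power_mono) auto
      moreover have "(r - 1)\<^sup>2 - K \<ge> r\<^sup>2 / 2"
      proof -
        have "r * r \<ge> 8 * r" using r8 by (intro mult_right_mono) auto
        with r4K show ?thesis by (simp add: power2_eq_square algebra_simps)
      qed
      ultimately have "(norm (sum_list xs + e))\<^sup>2 - K \<ge> real (Suc n) powr (2 * b)"
        using r n2 by linarith
      then have "ln (real (Suc n) powr (2 * b)) \<le> ln ((norm (sum_list xs + e))\<^sup>2 - K)"
        by (intro ln_mono) auto
      then show ?thesis by (simp add: potential_def ne ln_powr)
    qed
    have shift: "step_mean p xs (\<lambda>e. potential K b (xs @ [e]))
        = step_mean p xs (\<lambda>e. ln ((norm (sum_list xs + e))\<^sup>2 - K)) - 2 * b * ln (real (Suc n))"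
    proof -
      have "step_mean p xs (\<lambda>e. potential K b (xs @ [e]))
        = step_mean p xs (\<lambda>e. ln ((norm (sum_list xs + e))\<^sup>2 - K)) - step_mean p xs (\<lambda>_. 2 * b * ln (real (Suc n)))"
        by (simp add: step_mean_def potential_def ne right_diff_distrib sum_subtractf)
      then show ?thesis by (simp add: step_mean_const ne)
    qed
    have log: "step_mean p xs (\<lambda>e. ln ((norm (sum_list xs + e))\<^sup>2 - K))
        \<le> ln W + 2 * a / real n + (2 * K + 19) / (real n * W) + 5 * (imbalance xs)\<^sup>2 / (K * (real n)\<^sup>2)"
    proof -
      have "10 \<le> K" "2 * K \<le> (norm (sum_list xs))\<^sup>2"
        using K r4K by (simp_all add: r_def)
      from step_mean_log_le[OF ne(1,2) p_range this] show ?thesis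
        unfolding a_def W_def r_def ne(3) .
    qed
    have drift: "2 * a / real n + (2 * K + 19) / (real n * W) \<le> 2 * b * (ln (real (Suc n)) - ln (real n))"
    proof -
      have "1 / W \<le> 1 / (real n powr (2 * s) / 2)"
        using npos by (intro divide_left_mono mult_pos_pos W) auto
      also have "\<dots> = 2 * real n powr (- 2 * s)"
        by (simp add: powr_minus_divide)
      finally have "(2 * K + 19) * (1 / W) \<le> (2 * K + 19) * (2 * real n powr (- 2 * s))"
        using K by (intro mult_left_mono) auto
      then have "(2 * K + 19) / W \<le> (2 * K + 19) * 2 * real n powr (- 2 * s)"
        by (simp only: mult.assoc times_divide_eq_right mult_1_right)
      then have "2 * a + (2 * K + 19) / W \<le> 2 * b * (real n / (real n + 1))"
        using n3 by linarith
      then have "(2 * a + (2 * K + 19) / W) / real n \<le> 2 * b * (real n / (real n + 1)) / real n"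
        by (intro divide_right_mono) auto
      also have "\<dots> = 2 * b * (1 / (real n + 1))"
      proof -
        have "real n \<noteq> 0" "real n + 1 \<noteq> 0" using n by auto
        then show ?thesis by (simp add: divide_simps)
      qed
      also have "\<dots> \<le> 2 * b * (ln (real (Suc n)) - ln (real n))"
        using one_over_le_ln_increment[of n] n b by (intro mult_left_mono) auto
      finally show ?thesis by (simp add: add_divide_distrib mult.commute)
    qed
    have "potential K b xs = ln W - 2 * b * ln (real n)"
      by (simp add: potential_def ne W_def r_def)
    moreover have "5 / (K * real n ^ 2) * (imbalance xs)\<^sup>2 = 5 * (imbalance xs)\<^sup>2 / (K * (real n)\<^sup>2)"
      by simp
    ultimately have "step_mean p xs (\<lambda>e. potential K b (xs @ [e]))
        \<le> potential K b xs + 5 / (K * real n ^ 2) * (imbalance xs)\<^sup>2"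
      using shift log drift unfolding right_diff_distrib by linarith
    with low nonneg show "2 * (s - b) * ln (real n) - ln 2 \<le> potential K b xs \<and>
     (\<forall>e\<in>unit_steps. 0 \<le> potential K b (xs @ [e])) \<and>
     step_mean p xs (\<lambda>e. potential K b (xs @ [e]))
       \<le> potential K b xs + 5 / (K * real n ^ 2) * (imbalance xs)\<^sup>2"
      by blast
  qed
qed

text \<open>
  The mean of the potential over the paths that are still outside increases only through the
  imbalance, by at most \<open>5 C / (K n)\<close> at time \<open>n\<close>; and on each of these paths the potential is at
  least \<open>2 (s - b) ln n - ln 2\<close>.
\<close>

lemma stays_outside_growth:
  assumes b: "a < b" "0 < b" "b < s" and K: "K \<ge> 16"
    and C: "C > 0" "\<And>n. n \<ge> 1 \<Longrightarrow> hist_mean n (\<lambda>xs. (imbalance xs)\<^sup>2) \<le> C * real n"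
  shows "\<forall>\<^sub>F N in sequentially. \<exists>c. \<forall>n\<ge>N.
    hist_mean n (\<lambda>xs. of_bool (stays_outside s N xs)) * (2 * (s - b) * ln (real n) - ln 2)
      \<le> c + 10 * C / K * ln (real n)"
proof -
  from potential_step[OF b K] obtain N0 where N0: "\<forall>n\<ge>N0. \<forall>N\<le>n. \<forall>xs\<in>histories n. stays_outside s N xs \<longrightarrow>
     2 * (s - b) * ln (real n) - ln 2 \<le> potential K b xs \<and>
     (\<forall>e\<in>unit_steps. 0 \<le> potential K b (xs @ [e])) \<and>
     step_mean p xs (\<lambda>e. potential K b (xs @ [e]))
       \<le> potential K b xs + 5 / (K * real n ^ 2) * (imbalance xs)\<^sup>2"
    unfolding eventually_sequentially by (rule exE)
  note low = N0[rule_format, THEN conjunct1]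
    and nonneg = N0[rule_format, THEN conjunct2, THEN conjunct1, rule_format]
    and drift = N0[rule_format, THEN conjunct2, THEN conjunct2]
  show ?thesis
    unfolding eventually_sequentially
  proof (intro exI[of _ "max 1 N0"] allI impI)
    fix N assume "max 1 N0 \<le> N"
    then have N: "1 \<le> N" "N0 \<le> N" by auto
    \<comment> \<open>the potential, killed when the walk enters the region below the curve\<close>
    define V where "V xs = of_bool (stays_outside s N xs) * potential K b xs" for xs
    have V_step: "step_mean p xs (\<lambda>e. V (xs @ [e])) \<le> V xs + 5 / (K * real n ^ 2) * (imbalance xs)\<^sup>2"
      if n: "N \<le> n" and xs: "xs \<in> histories n" for n xs
    proof (cases "stays_outside s N xs")
      case True
      have N0n: "N0 \<le> n" using N n by simp
      have "step_mean p xs (\<lambda>e. V (xs @ [e])) \<le> step_mean p xs (\<lambda>e. potential K b (xs @ [e]))"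
        using nonneg[OF N0n n xs True] by (intro step_mean_mono p_range) (simp add: V_def)
      also have "\<dots> \<le> V xs + 5 / (K * real n ^ 2) * (imbalance xs)\<^sup>2"
        using drift[OF N0n n xs True] True by (simp only: V_def of_bool_eq mult_1_left)
      finally show ?thesis .
    next
      case False
      then have "V (xs @ [e]) = 0" for e
        using stays_outside_snocD by (auto simp: V_def)
      then have "step_mean p xs (\<lambda>e. V (xs @ [e])) = 0" by (simp only: step_mean_def) simp
      then show ?thesis using False K by (simp add: V_def)
    qed
    have mean: "hist_mean n V \<le> hist_mean N V + 10 * C / K * (ln (real n) - ln (real N))"
      if "n \<ge> N" for n
      using that
    proof (induction n rule: nat_induct_at_least)
      case base
      then show ?case by simp
    next
      case (Suc n)
      then have n: "1 \<le> n" using N by simp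
      have "hist_mean (Suc n) V = hist_mean n (\<lambda>xs. step_mean p xs (\<lambda>e. V (xs @ [e])))"
        by (rule hist_mean_Suc) fact
      also have "\<dots> \<le> hist_mean n (\<lambda>xs. V xs + 5 / (K * real n ^ 2) * (imbalance xs)\<^sup>2)"
        by (intro hist_mean_mono V_step Suc.hyps)
      also have "\<dots> = hist_mean n V + 5 / (K * real n ^ 2) * hist_mean n (\<lambda>xs. (imbalance xs)\<^sup>2)"
        by (simp only: hist_mean_add hist_mean_cmult)
      also have "5 / (K * real n ^ 2) * hist_mean n (\<lambda>xs. (imbalance xs)\<^sup>2) \<le> 5 / (K * real n ^ 2) * (C * real n)"
        using C(2)[OF n] K by (intro mult_left_mono) auto
      also have "\<dots> = 5 * C / K * (1 / real n)"
        using n by (simp add: power2_eq_square)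
      also have "\<dots> \<le> 5 * C / K * (2 * (1 / (real n + 1)))"
        using n C(1) K by (intro mult_left_mono) (auto simp: field_simps)
      also have "\<dots> \<le> 5 * C / K * (2 * (ln (real (Suc n)) - ln (real n)))"
        using one_over_le_ln_increment[OF n] C(1) K by (intro mult_left_mono) auto
      also have "5 * C / K * (2 * x) = 10 * C / K * x" for x
        by simp
      finally have "hist_mean (Suc n) V \<le> hist_mean n V + 10 * C / K * (ln (real (Suc n)) - ln (real n))"
        by simp
      also have "\<dots> \<le> hist_mean N V + 10 * C / K * (ln (real n) - ln (real N))
          + 10 * C / K * (ln (real (Suc n)) - ln (real n))"
        using Suc.IH by simp
      also have "\<dots> = hist_mean N V + 10 * C / K * (ln (real (Suc n)) - ln (real N))"
        by (simp only: right_diff_distrib)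
      finally show ?case .
    qed
    show "\<exists>c. \<forall>n\<ge>N. hist_mean n (\<lambda>xs. of_bool (stays_outside s N xs)) * (2 * (s - b) * ln (real n) - ln 2)
      \<le> c + 10 * C / K * ln (real n)"
    proof (intro exI[of _ "hist_mean N V - 10 * C / K * ln (real N)"] allI impI)
      fix n assume n: "N \<le> n"
      let ?l = "2 * (s - b) * ln (real n) - ln 2"
      have "hist_mean n (\<lambda>xs. of_bool (stays_outside s N xs)) * ?l
          = hist_mean n (\<lambda>xs. ?l * of_bool (stays_outside s N xs))"
        by (simp add: hist_mean_cmult)
      also have "\<dots> \<le> hist_mean n V"
      proof (rule hist_mean_mono)
        fix xs :: "(real ^ 2) list" assume xs: "xs \<in> histories n"
        show "?l * of_bool (stays_outside s N xs) \<le> V xs"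
        proof (cases "stays_outside s N xs")
          case True
          have "?l \<le> potential K b xs" using low[OF _ n xs True] N n by simp
          then show ?thesis using True by (simp add: V_def)
        qed (simp add: V_def)
      qed
      also have "\<dots> \<le> hist_mean N V + 10 * C / K * (ln (real n) - ln (real N))"
        by (rule mean) fact
      finally show "hist_mean n (\<lambda>xs. of_bool (stays_outside s N xs)) * ?l
          \<le> hist_mean N V - 10 * C / K * ln (real N) + 10 * C / K * ln (real n)"
        by (simp only: right_diff_distrib)
    qed
  qed
qed

lemma walk_measurable: "S n \<in> borel_measurable M"
proof (induction n)
  case 0
  have "S 0 \<in> borel_measurable M \<longleftrightarrow> (\<lambda>_. 0 :: real ^ 2) \<in> borel_measurable M"
    by (rule measurable_cong) (simp add: walk_0)
  then show ?case by simp
next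
  case (Suc n)
  have "S (Suc n) \<in> borel_measurable M \<longleftrightarrow> (\<lambda>\<omega>. S n \<omega> + \<sigma> (Suc n) \<omega>) \<in> borel_measurable M"
    by (rule measurable_cong) (simp add: walk_Suc)
  then show ?case using Suc step_measurable[of "Suc n"] by simp
qed

text \<open>
  Divide the inequality of \<open>stays_outside_growth\<close> by \<open>ln n\<close> and let \<open>n\<close> tend to infinity: the
  constant \<open>c\<close>, which depends on \<open>K\<close> and on the starting time, disappears.  Starting later only enlarges
  the event, so the bound holds for every \<open>N\<close>.
\<close>

lemma prob_eventually_outside_le:
  assumes b: "a < b" "0 < b" "b < s" and K: "K \<ge> 16"
    and C: "C > 0" "\<And>n. n \<ge> 1 \<Longrightarrow> hist_mean n (\<lambda>xs. (imbalance xs)\<^sup>2) \<le> C * real n"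
  shows "prob {\<omega> \<in> space M. \<forall>m\<ge>N. real m powr s < norm (S m \<omega>)} \<le> 5 * C / (K * (s - b))"
    (is "prob ?A \<le> _")
proof -
  have [measurable]: "S n \<in> borel_measurable M" for n by (rule walk_measurable)
  have "\<forall>\<^sub>F N' in sequentially. N \<le> N' \<and> 1 \<le> N' \<and> (\<exists>c. \<forall>n\<ge>N'.
    hist_mean n (\<lambda>xs. of_bool (stays_outside s N' xs)) * (2 * (s - b) * ln (real n) - ln 2)
      \<le> c + 10 * C / K * ln (real n))"
    by (intro eventually_conj eventually_ge_at_top stays_outside_growth assms)
  then obtain N' c where N': "N \<le> N'" "1 \<le> N'" and c: "\<And>n. n \<ge> N' \<Longrightarrow>
    hist_mean n (\<lambda>xs. of_bool (stays_outside s N' xs)) * (2 * (s - b) * ln (real n) - ln 2)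
      \<le> c + 10 * C / K * ln (real n)"
    unfolding eventually_sequentially by blast
  have A: "prob ?A \<le> hist_mean n (\<lambda>xs. of_bool (stays_outside s N' xs))" if "n \<ge> N'" for n
  proof (rule prob_le_hist_mean)
    fix xs \<omega> assume "xs \<in> histories n" and \<omega>: "\<omega> \<in> follows xs" "\<omega> \<in> ?A"
    show "stays_outside s N' xs"
      unfolding stays_outside_def
    proof
      fix m assume "m \<in> {N'..length xs}"
      then show "real m powr s < norm (sum_list (take m xs))"
        using walk_eq_sum_list[OF \<omega>(1), of m, symmetric] \<omega>(2) N' by auto
    qed
  qed (use that N' in auto)
  have "filterlim (\<lambda>n. ln (real n)) at_top sequentially" by real_asymp
  then have "\<forall>\<^sub>F n in sequentially. ln 2 / (2 * (s - b)) < ln (real n)"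
    unfolding filterlim_at_top_dense by blast
  then have "\<forall>\<^sub>F n in sequentially. 0 < 2 * (s - b) * ln (real n) - ln 2"
    by eventually_elim (use b in \<open>simp add: pos_divide_less_eq mult.commute\<close>)
  moreover have "\<forall>\<^sub>F n in sequentially. 0 < ln (real n)" by real_asymp
  ultimately have "\<forall>\<^sub>F n in sequentially.
      prob ?A * (2 * (s - b) - ln 2 / ln (real n)) \<le> c / ln (real n) + 10 * C / K"
    using eventually_ge_at_top[of N']
  proof eventually_elim
    case (elim n)
    have "prob ?A * (2 * (s - b) * ln (real n) - ln 2)
        \<le> hist_mean n (\<lambda>xs. of_bool (stays_outside s N' xs)) * (2 * (s - b) * ln (real n) - ln 2)"
      using elim A by (intro mult_right_mono) auto
    also have "\<dots> \<le> c + 10 * C / K * ln (real n)" by (rule c) (use elim in auto)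
    finally have "prob ?A * (2 * (s - b) * ln (real n) - ln 2) / ln (real n)
        \<le> (c + 10 * C / K * ln (real n)) / ln (real n)"
      using elim by (intro divide_right_mono) auto
    then show ?case
      using elim by (simp add: diff_divide_distrib add_divide_distrib right_diff_distrib)
  qed
  moreover have lim: "(\<lambda>n. u / ln (real n)) \<longlonglongrightarrow> 0" for u
    using tendsto_mult_right_zero[of "\<lambda>n. 1 / ln (real n)" sequentially u] by simp real_asymp
  have "(\<lambda>n. prob ?A * (2 * (s - b) - ln 2 / ln (real n))) \<longlonglongrightarrow> prob ?A * (2 * (s - b) - 0)"
    by (intro tendsto_intros lim)
  moreover have "(\<lambda>n. c / ln (real n) + 10 * C / K) \<longlonglongrightarrow> 0 + 10 * C / K"
    by (intro tendsto_intros lim)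
  ultimately have "prob ?A * (2 * (s - b)) \<le> 10 * C / K"
    by (intro tendsto_le[OF sequentially_bot]) auto
  then show ?thesis using b K by (simp add: field_simps)
qed

lemma AE_infinitely_often_inside:
  assumes "a < s" "0 < s"
  shows "AE \<omega> in M. infinite {n. norm (S n \<omega>) \<le> real n powr s}"
proof -
  have [measurable]: "S n \<in> borel_measurable M" for n by (rule walk_measurable)
  obtain b where b: "max a 0 < b" "b < s"
    using dense[of "max a 0" s] assms by auto
  obtain C where C: "C > 0" "\<And>n. n \<ge> 1 \<Longrightarrow> hist_mean n (\<lambda>xs. (imbalance xs)\<^sup>2) \<le> C * real n"
    using imbalance_second_moment by blast
  have "AE \<omega> in M. \<not> (\<forall>m\<ge>N. real m powr s < norm (S m \<omega>))" for N
  proof -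
    let ?A = "{\<omega> \<in> space M. \<forall>m\<ge>N. real m powr s < norm (S m \<omega>)}"
    have "\<forall>\<^sub>F K in at_top. prob ?A \<le> 5 * C / (K * (s - b))"
      using eventually_ge_at_top[of 16]
      by eventually_elim (rule prob_eventually_outside_le; use b C in auto)
    moreover have "((\<lambda>K. 5 * C / (s - b) * (1 / K)) \<longlongrightarrow> 5 * C / (s - b) * 0) at_top"
      by (intro tendsto_mult tendsto_const) real_asymp
    then have "((\<lambda>K. 5 * C / (K * (s - b))) \<longlongrightarrow> 0) at_top"
      by (simp add: mult.commute)
    ultimately have "prob ?A \<le> 0"
      using tendsto_lowerbound[of "\<lambda>K. 5 * C / (K * (s - b))" 0 at_top "prob ?A"] by simp
    then have "prob ?A = 0" by (simp add: measure_le_0_iff)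
    then have "AE \<omega> in M. \<omega> \<notin> ?A" by (subst (asm) prob_eq_0) auto
    then show ?thesis by auto
  qed
  then have "AE \<omega> in M. \<forall>N. \<not> (\<forall>m\<ge>N. real m powr s < norm (S m \<omega>))"
    by (simp add: AE_all_countable)
  then show ?thesis
    by (auto simp: infinite_nat_iff_unbounded_le not_less)
qed

end

theorem proposition1p15:
  fixes M :: "'w measure"
    and S \<sigma> :: "nat \<Rightarrow> 'w \<Rightarrow> real ^ 2"
    and \<nu> :: "nat \<Rightarrow> 'w \<Rightarrow> nat"
    and p a s :: real
  assumes "elephant_random_walk M p S \<sigma> \<nu>"
    and "p \<in> {0..<5/8}"
    and "a = (4 * p - 1) / 3"
    and "s \<in> {a<..<1/2}" and "s > 0"
  shows "AE \<omega> in M. infinite {n. norm (S n \<omega>) \<le> real n powr s}"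
proof -
  interpret planar_elephant_random_walk M p S \<sigma> \<nu> "(4 * p - 1) / 3"
    using assms(1,2)
    by (auto simp: planar_elephant_random_walk_def planar_elephant_random_walk_axioms_def)
  show ?thesis
    using assms by (intro AE_infinitely_often_inside) auto
qed

end
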